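(* Let $\mathcal{R}=\mathbb{C}[\partial]L\oplus\mathbb{C}[\partial]I$ be the Lie conformal algebra, free of rank $2$ over $\mathbb{C}[\partial]$, with $[L_\lambda L]=(\partial+2\lambda)(L+I)$, $[L_\lambda I]=(\partial+\lambda)I$, $[I_\lambda L]=\lambda I$, $[I_\lambda I]=0$. Let $V$ be a finite nontrivial irreducible conformal $\mathcal{R}$-module. Then there exist some $\alpha\in\mathbb{C}$ and $\Delta\in\mathbb{C}^*$ such that $$V\cong V(\alpha,\Delta)=\mathbb{C}[\partial]v_\Delta,\qquad L_\lambda v_\Delta=(\partial+\alpha+\Delta\lambda)v_\Delta,\qquad I_\lambda v_\Delta=0,$$ where $\mathbb{C}[\partial]v_\Delta$ is free of rank one over $\mathbb{C}[\partial]$.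
   Context: A conformal module $V$ over a Lie conformal algebra $R$ is a $\mathbb{C}[\partial]$-module with a $\mathbb{C}$-linear map $R\to \mathrm{End}_{\mathbb{C}}(V)\otimes\mathbb{C}[\lambda]$, $a\mapsto a_\lambda$, such that for all $a,b\in R$: $a_\lambda b_\mu-b_\mu a_\lambda=[a_\lambda b]_{\lambda+\mu}$ and $(\partial a)_\lambda=[\partial,a_\lambda]=-\lambda a_\lambda$ (so $a_\lambda(\partial v)=(\partial+\lambda)a_\lambda v$). It is finite if it is finitely generated over $\mathbb{C}[\partial]$. It is trivial if $R_\lambda v=0$ for all $v\in V$, and nontrivial otherwise. A submodule is a $\mathbb{C}[\partial]$-submodule $U$ with $a_\lambda U\subseteq U[\lambda]$ for all $a\in R$; $V$ is irreducible if it has no submodules other than $0$ and $V$. $\mathbb{C}^*$ denotes the nonzero complex numbers. *)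

theory Defs
  imports Complex_Main "HOL-Computational_Algebra.Polynomial"
begin

(* A C[\<partial>]-module is a module (HOL.Modules) over the ring "complex poly", whose variable is
   \<partial>; a scalar c acts as [:c:].  V[\<lambda>] is 'v poly, so a_\<lambda> v = \<Sum>n. \<lambda>^n (a_n v) is the polynomial
   with coefficients a_n v in V.  C[\<partial>][\<lambda>] is "complex poly poly" (outer variable \<lambda>). *)

abbreviation del :: "complex poly" where
  "del \<equiv> [:0, 1:]"

(* P(\<partial>,\<lambda>) v, an element of V[\<lambda>] *)
definition lam_scale ::
    "(complex poly \<Rightarrow> 'v \<Rightarrow> 'v) \<Rightarrow> complex poly poly \<Rightarrow> 'v \<Rightarrow> 'v::ab_group_add poly" where
  "lam_scale s P v = map_poly (\<lambda>p. s p v) P"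

locale sesquilinear_action =
  R: module sR + V: module sV
  for sR :: "complex poly \<Rightarrow> 'r::ab_group_add \<Rightarrow> 'r"
    and sV :: "complex poly \<Rightarrow> 'v::ab_group_add \<Rightarrow> 'v" +
  fixes act :: "'r \<Rightarrow> 'v \<Rightarrow> 'v poly"
  assumes add_left: "act (a + b) v = act a v + act b v"
    and scale_left: "act (sR [:c:] a) v = map_poly (sV [:c:]) (act a v)"
    and add_right: "act a (v + w) = act a v + act a w"
    and scale_right: "act a (sV [:c:] v) = map_poly (sV [:c:]) (act a v)"
    and del_left: "act (sR del a) v = - pCons 0 (act a v)"
    and del_right: "act a (sV del v) = map_poly (sV del) (act a v) + pCons 0 (act a v)"

(* Coefficient of \<lambda>^m \<mu>^n in p(\<lambda> + \<mu>). *)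
definition coeff_sum_subst ::
    "(complex poly \<Rightarrow> 'v \<Rightarrow> 'v) \<Rightarrow> 'v::ab_group_add poly \<Rightarrow> nat \<Rightarrow> nat \<Rightarrow> 'v" where
  "coeff_sum_subst s p m n = s (of_nat ((m + n) choose m)) (coeff p (m + n))"

(* a_\<lambda> b_\<mu> v - b_\<mu> a_\<lambda> v = [a_\<lambda> b]_{\<lambda>+\<mu>} v in V[\<lambda>,\<mu>], comparing coefficients of \<lambda>^m \<mu>^n.
   On the right, [a_\<lambda> b]_{\<lambda>+\<mu>} v = \<Sum>j. \<lambda>^j ((coeff (br a b) j)_{\<lambda>+\<mu>} v). *)
definition commutator_identity ::
    "('r \<Rightarrow> 'r \<Rightarrow> 'r::ab_group_add poly) \<Rightarrow> (complex poly \<Rightarrow> 'v \<Rightarrow> 'v) \<Rightarrow>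
     ('r \<Rightarrow> 'v \<Rightarrow> 'v::ab_group_add poly) \<Rightarrow> bool" where
  "commutator_identity br sV act \<longleftrightarrow>
    (\<forall>a b v m n.
      coeff (act a (coeff (act b v) n)) m - coeff (act b (coeff (act a v) m)) n =
      (\<Sum>j\<le>m. coeff_sum_subst sV (act (coeff (br a b) j) v) (m - j) n))"

(* The Jacobi identity [a_\<lambda> [b_\<mu> c]] = [[a_\<lambda> b]_{\<lambda>+\<mu>} c] + [b_\<mu> [a_\<lambda> c]] is the commutator
   identity of the adjoint action; skew-symmetry is [a_\<lambda> b] = - [b_{-\<lambda>-\<partial>} a], with the powers
   of -\<lambda>-\<partial> placed to the left of the coefficients. *)
locale lie_conformal_algebra =
  sesquilinear_action sR sR br
  for sR :: "complex poly \<Rightarrow> 'r::ab_group_add \<Rightarrow> 'r" and br :: "'r \<Rightarrow> 'r \<Rightarrow> 'r poly" +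
  assumes skew_symmetry:
      "br a b = - (\<Sum>j\<le>degree (br b a). lam_scale sR ([:- del, - 1:] ^ j) (coeff (br b a) j))"
    and jacobi: "commutator_identity br sR br"

locale conformal_module =
  lie_conformal_algebra sR br + M: sesquilinear_action sR sV act
  for sR :: "complex poly \<Rightarrow> 'r::ab_group_add \<Rightarrow> 'r" and br :: "'r \<Rightarrow> 'r \<Rightarrow> 'r poly"
    and sV :: "complex poly \<Rightarrow> 'v::ab_group_add \<Rightarrow> 'v" and act :: "'r \<Rightarrow> 'v \<Rightarrow> 'v poly" +
  assumes commutator: "commutator_identity br sV act"

definition finite_module :: "(complex poly \<Rightarrow> 'v::ab_group_add \<Rightarrow> 'v) \<Rightarrow> bool" where
  "finite_module sV \<longleftrightarrow> (\<exists>S. finite S \<and> module.span sV S = UNIV)"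

definition trivial_action :: "('r \<Rightarrow> 'v \<Rightarrow> 'v::ab_group_add poly) \<Rightarrow> bool" where
  "trivial_action act \<longleftrightarrow> (\<forall>a v. act a v = 0)"

definition conformal_submodule ::
    "(complex poly \<Rightarrow> 'v \<Rightarrow> 'v) \<Rightarrow> ('r \<Rightarrow> 'v \<Rightarrow> 'v::ab_group_add poly) \<Rightarrow> 'v set \<Rightarrow> bool" where
  "conformal_submodule sV act U \<longleftrightarrow>
    module.subspace sV U \<and> (\<forall>a. \<forall>u\<in>U. \<forall>n. coeff (act a u) n \<in> U)"

definition irreducible_module ::
    "(complex poly \<Rightarrow> 'v \<Rightarrow> 'v) \<Rightarrow> ('r \<Rightarrow> 'v \<Rightarrow> 'v::ab_group_add poly) \<Rightarrow> bool" where
  "irreducible_module sV act \<longleftrightarrow>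
    (\<forall>U. conformal_submodule sV act U \<longrightarrow> U = {0} \<or> U = UNIV)"

definition isomorphic_modules ::
    "(complex poly \<Rightarrow> 'v \<Rightarrow> 'v) \<Rightarrow> ('r \<Rightarrow> 'v \<Rightarrow> 'v::ab_group_add poly) \<Rightarrow>
     (complex poly \<Rightarrow> 'w \<Rightarrow> 'w) \<Rightarrow> ('r \<Rightarrow> 'w \<Rightarrow> 'w::ab_group_add poly) \<Rightarrow> bool" where
  "isomorphic_modules sV actV sW actW \<longleftrightarrow>
    (\<exists>f. module_hom sV sW f \<and> bij f \<and> (\<forall>a v. actW a (f v) = map_poly f (actV a v)))"

locale algebra_R =
  lie_conformal_algebra sR br
  for sR :: "complex poly \<Rightarrow> 'r::ab_group_add \<Rightarrow> 'r" and br :: "'r \<Rightarrow> 'r \<Rightarrow> 'r poly" +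
  fixes L I :: 'r
  assumes L_neq_I: "L \<noteq> I"
    and independent_LI: "R.independent {L, I}"
    and span_LI: "R.span {L, I} = UNIV"
    and bracket_LL: "br L L = lam_scale sR [:del, 2:] (L + I)"
    and bracket_LI: "br L I = lam_scale sR [:del, 1:] I"
    and bracket_IL: "br I L = lam_scale sR [:0, 1:] I"
    and bracket_II: "br I I = 0"

(* V(\<alpha>,\<Delta>): the free module C[\<partial>] v with v = 1, i.e. "complex poly" as a module over itself.
   The action on all of C[\<partial>] v is determined by the two values on v through sesquilinearity. *)
definition is_V_module ::
    "(complex poly \<Rightarrow> 'r \<Rightarrow> 'r) \<Rightarrow> ('r \<Rightarrow> 'r \<Rightarrow> 'r::ab_group_add poly) \<Rightarrow> 'r \<Rightarrow> 'r \<Rightarrow>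
     complex \<Rightarrow> complex \<Rightarrow> ('r \<Rightarrow> complex poly \<Rightarrow> complex poly poly) \<Rightarrow> bool" where
  "is_V_module sR br L I \<alpha> \<Delta> act \<longleftrightarrow>
    conformal_module sR br (*) act \<and>
    act L 1 = lam_scale (*) [:del + [:\<alpha>:], [:\<Delta>:]:] 1 \<and>
    act I 1 = 0"

end

theory Submission
  imports Defs "HOL-Computational_Algebra.Fundamental_Theorem_Algebra"
begin

text \<open>
  Write \<open>L\<^sub>n\<close> and \<open>I\<^sub>n\<close> for the coefficients of \<open>\<lambda>\<^sup>n\<close> in the actions of \<open>L\<close> and \<open>I\<close> on \<open>V\<close>. These are
  \<open>\<complex>\<close>-linear operators, and the theorem comes down to finding a common eigenvector of
  \<open>L\<^sub>1\<close> and \<open>\<partial> - L\<^sub>0\<close> on which \<open>I\<close> and all \<open>L\<^sub>n\<close> with \<open>n \<ge> 2\<close> vanish. The difficulty is that \<open>V\<close> is infinite-dimensional over \<open>\<complex>\<close>.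

  Consider therefore the spaces \<open>Trunc N M\<close> of all \<open>v\<close> with \<open>L\<^sub>n v = 0\<close> for \<open>n \<ge> N\<close> and \<open>I\<^sub>n v = 0\<close> for
  \<open>n \<ge> M\<close>. They exhaust \<open>V\<close>, and each is finite-dimensional. For suppose that the polynomials
  \<open>a\<^sub>\<lambda> v\<close> have degree at most \<open>n\<close> for every \<open>v\<close> in some family. Since
  \<open>a\<^sub>\<lambda> (p(\<partial>) v) = p(\<partial> + \<lambda>) a\<^sub>\<lambda> v\<close>, a relation over \<open>\<complex>[\<partial>]\<close> between members of the family yields, in top
  degree in \<open>\<lambda>\<close>, a relation over \<open>\<complex>\<close> between the coefficients of \<open>\<lambda>\<^sup>n\<close>. Hence these coefficients
  span a space whose dimension is at most the number of generators of \<open>V\<close>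
  (\<open>rank_bounds_leading_coeffs\<close>). Raising \<open>N\<close> or \<open>M\<close> by one thus adds finitely many dimensions only,
  while \<open>Trunc 0 0\<close>, the part of \<open>V\<close> killed by the whole algebra, vanishes because \<open>V\<close> is
  irreducible and nontrivial.

  First, \<open>I\<close> acts as zero (\<open>I_acts_zero\<close>). The common kernel of all \<open>I\<^sub>n\<close> is a submodule, so it is
  enough to find a nonzero vector in it. Take a large \<open>N\<close> and the least \<open>M\<close> with \<open>Trunc N M \<noteq> 0\<close>. If
  \<open>M > 0\<close>, then \<open>I\<^bsub>M-1\<^esub>\<close> is injective on that space. For \<open>M \<ge> 2\<close> this contradicts
  \<open>[L\<^sub>1, I\<^bsub>M-1\<^esub>] = -(M-1) I\<^bsub>M-1\<^esub>\<close>, which shifts eigenvalues of \<open>L\<^sub>1\<close>. For \<open>M = 1\<close> the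
  term \<open>I\<close> in \<open>[L\<^sub>\<lambda> L]\<close> enters: with \<open>D = \<partial> - L\<^sub>0\<close> one finds \<open>[D, L\<^sub>1] = I\<^sub>0\<close>, where \<open>I\<^sub>0\<close> commutes with
  \<open>D\<close> and \<open>L\<^sub>1\<close>, and such a relation forces \<open>I\<^sub>0\<close> to have a kernel in finite dimension.

  Once \<open>I\<close> is gone, \<open>[L\<^sub>1, L\<^bsub>N-1\<^esub>] = -(N-2) L\<^bsub>N-1\<^esub>\<close> shows in the same way that \<open>Trunc 2 0\<close> is
  nonzero, and there the commuting operators \<open>L\<^sub>1\<close> and \<open>D\<close> have a common eigenvector \<open>v\<close>, that is,
  \<open>L\<^sub>\<lambda> v = (\<partial> + \<alpha> + \<Delta> \<lambda>) v\<close>. If \<open>\<Delta> = 0\<close>, then \<open>(\<partial> + \<alpha>) v\<close> is such a vector too, with \<open>\<Delta> = 1\<close>. Finally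
  \<open>\<complex>[\<partial>] v\<close> is a submodule, hence everything, and it is free because a torsion element is killed by
  the whole algebra.
\<close>

section \<open>Linear relations over a domain\<close>

text \<open>A homogeneous linear system with more unknowns than equations has a nonzero solution over any
  domain: eliminate one unknown with cross multiplication in place of division.\<close>
lemma exists_left_kernel_vector:
  fixes q :: "'b \<Rightarrow> 's \<Rightarrow> 'a::idom"
  assumes "finite S" "finite B" "card S < card B"
  shows "\<exists>p. (\<exists>b\<in>B. p b \<noteq> 0) \<and> (\<forall>s\<in>S. (\<Sum>b\<in>B. p b * q b s) = 0)"
  using assms
proof (induction S arbitrary: B q rule: finite_induct)
  case empty
  then have "B \<noteq> {}" by auto
  then show ?case by (intro exI[of _ "\<lambda>_. 1"]) auto
next
  case (insert s S)
  show ?case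
  proof (cases "\<forall>b\<in>B. q b s = 0")
    case True
    have "\<exists>p. (\<exists>b\<in>B. p b \<noteq> 0) \<and> (\<forall>t\<in>S. (\<Sum>b\<in>B. p b * q b t) = 0)"
      using insert by (intro insert.IH) auto
    then obtain p where p: "\<exists>b\<in>B. p b \<noteq> 0" "\<forall>t\<in>S. (\<Sum>b\<in>B. p b * q b t) = 0"
      by blast
    have "(\<Sum>b\<in>B. p b * q b s) = 0" using True by simp
    with p show ?thesis by (intro exI[of _ p]) auto
  next
    case False
    then obtain b0 where b0: "b0 \<in> B" "q b0 s \<noteq> 0" by blast
    define C where "C = B - {b0}"
    have C: "finite C" "b0 \<notin> C" "B = insert b0 C"
      using insert.prems b0 by (auto simp: C_def)
    have "card S < card C" using insert.prems insert.hyps C by simp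
    then have "\<exists>p. (\<exists>b\<in>C. p b \<noteq> 0) \<and>
        (\<forall>t\<in>S. (\<Sum>b\<in>C. p b * (q b0 s * q b t - q b s * q b0 t)) = 0)"
      using C by (intro insert.IH) auto
    then obtain p where p: "\<exists>b\<in>C. p b \<noteq> 0"
      "\<And>t. t \<in> S \<Longrightarrow> (\<Sum>b\<in>C. p b * (q b0 s * q b t - q b s * q b0 t)) = 0"
      by blast
    define p' where "p' b = (if b = b0 then - (\<Sum>b\<in>C. p b * q b s) else q b0 s * p b)" for b
    have split: "(\<Sum>b\<in>B. p' b * q b t) =
        (\<Sum>b\<in>C. p b * (q b0 s * q b t - q b s * q b0 t))" for t
    proof -
      have "(\<Sum>b\<in>C. p' b * q b t) = (\<Sum>b\<in>C. q b0 s * p b * q b t)"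
        using C by (intro sum.cong) (auto simp: p'_def)
      then have "(\<Sum>b\<in>B. p' b * q b t) =
          - (\<Sum>b\<in>C. p b * q b s) * q b0 t + (\<Sum>b\<in>C. q b0 s * p b * q b t)"
        using C by (simp add: p'_def)
      also have "\<dots> = (\<Sum>b\<in>C. p b * (q b0 s * q b t - q b s * q b0 t))"
        by (simp add: sum_distrib_left right_diff_distrib sum_subtractf mult_ac)
      finally show ?thesis .
    qed
    have "\<exists>b\<in>B. p' b \<noteq> 0"
    proof -
      from p(1) obtain b where "b \<in> C" "p b \<noteq> 0" by blast
      with b0 C show ?thesis by (intro bexI[of _ b]) (auto simp: p'_def)
    qed
    moreover have "(\<Sum>b\<in>B. p' b * q b t) = 0" if "t \<in> insert s S" for t
      using that p(2) by (auto simp: split mult.commute)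
    ultimately show ?thesis by blast
  qed
qed

text \<open>This is used twice: over \<open>\<complex>\<close>, and over \<open>\<complex>[\<partial>]\<close> where it bounds the rank of a finitely generated
  module.\<close>
lemma nontrivial_relation_in_span:
  fixes scale :: "'a::idom \<Rightarrow> 'v::ab_group_add \<Rightarrow> 'v"
  assumes "module scale" and "finite S" "finite B" "card S < card B"
    and v: "\<And>b. b \<in> B \<Longrightarrow> v b \<in> module.span scale S"
  shows "\<exists>p. (\<exists>b\<in>B. p b \<noteq> 0) \<and> (\<Sum>b\<in>B. scale (p b) (v b)) = 0"
proof -
  interpret module scale by fact
  have "\<forall>b\<in>B. \<exists>q. v b = (\<Sum>s\<in>S. scale (q s) s)"
    using v unfolding span_finite[OF \<open>finite S\<close>] by blast
  then obtain q where q: "\<And>b. b \<in> B \<Longrightarrow> v b = (\<Sum>s\<in>S. scale (q b s) s)" by metis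
  obtain p where p: "\<exists>b\<in>B. p b \<noteq> 0" "\<And>s. s \<in> S \<Longrightarrow> (\<Sum>b\<in>B. p b * q b s) = 0"
    using exists_left_kernel_vector[OF assms(2-4), of q] by blast
  have "(\<Sum>b\<in>B. scale (p b) (v b)) = (\<Sum>b\<in>B. \<Sum>s\<in>S. scale (p b * q b s) s)"
    by (intro sum.cong) (auto simp: q scale_sum_right)
  also have "\<dots> = (\<Sum>s\<in>S. scale (\<Sum>b\<in>B. p b * q b s) s)"
    by (subst sum.swap) (simp add: scale_sum_left)
  also have "\<dots> = 0" by (simp add: p)
  finally show ?thesis using p(1) by blast
qed

section \<open>Operators on finite-dimensional complex spaces\<close>

locale complex_vector_space = vector_space scale
  for scale :: "complex \<Rightarrow> 'v::ab_group_add \<Rightarrow> 'v" (infixr \<open>\<cdot>\<close> 75)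
begin

definition finite_span :: "'v set \<Rightarrow> bool" where
  "finite_span W \<longleftrightarrow> (\<exists>T. finite T \<and> W \<subseteq> span T)"

lemma finite_span_subset: "finite_span W \<Longrightarrow> U \<subseteq> W \<Longrightarrow> finite_span U"
  unfolding finite_span_def by blast

lemma finite_span_if_kernel_image:
  assumes f: "module_hom scale scale f" and W: "subspace W"
    and ker: "finite_span {w\<in>W. f w = 0}"
    and img: "\<And>B. B \<subseteq> f ` W \<Longrightarrow> independent B \<Longrightarrow> finite B"
  shows "finite_span W"
proof -
  interpret f: module_hom scale scale f by fact
  obtain B where B: "B \<subseteq> f ` W" "independent B" "f ` W \<subseteq> span B"
    using maximal_independent_subset by blast
  then have "finite B" using img by blast
  have "\<forall>b\<in>B. \<exists>w\<in>W. f w = b" using B by blast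
  then obtain g where g: "\<And>b. b \<in> B \<Longrightarrow> g b \<in> W" "\<And>b. b \<in> B \<Longrightarrow> f (g b) = b" by metis
  obtain T where T: "finite T" "{w\<in>W. f w = 0} \<subseteq> span T"
    using ker unfolding finite_span_def by blast
  have "w \<in> span (T \<union> g ` B)" if "w \<in> W" for w
  proof -
    have "f w \<in> span B" using B that by blast
    then obtain c where c: "f w = (\<Sum>b\<in>B. c b \<cdot> b)"
      unfolding span_finite[OF \<open>finite B\<close>] by blast
    define u where "u = (\<Sum>b\<in>B. c b \<cdot> g b)"
    have "u \<in> W" unfolding u_def by (intro subspace_sum subspace_scale W g)
    moreover have "f u = f w" by (simp add: u_def c f.sum f.scale g)
    ultimately have "w - u \<in> {w\<in>W. f w = 0}"
      using that W by (simp add: f.diff subspace_diff)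
    then have "w - u \<in> span (T \<union> g ` B)"
      using T span_mono[of T "T \<union> g ` B"] by blast
    moreover have "u \<in> span (T \<union> g ` B)"
      unfolding u_def by (intro span_sum span_scale span_base) auto
    ultimately show ?thesis using span_add by fastforce
  qed
  with T \<open>finite B\<close> show ?thesis unfolding finite_span_def by (intro exI[of _ "T \<union> g ` B"]) auto
qed

lemma relation_of_sequence:
  assumes "finite_span W" and "\<And>i. u i \<in> W"
  shows "\<exists>(c :: nat \<Rightarrow> complex) N. (\<exists>i<N. c i \<noteq> 0) \<and> (\<Sum>i<N. c i \<cdot> u i) = 0"
proof -
  obtain T where T: "finite T" "W \<subseteq> span T" using assms unfolding finite_span_def by blast
  have "\<exists>p. (\<exists>b\<in>{..<Suc (card T)}. p b \<noteq> 0) \<and> (\<Sum>b\<in>{..<Suc (card T)}. p b \<cdot> u b) = 0"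
    using T assms(2) by (intro nontrivial_relation_in_span[where S=T]) (auto intro: module_axioms)
  then obtain p where "\<exists>i<Suc (card T). p i \<noteq> 0" "(\<Sum>i<Suc (card T). p i \<cdot> u i) = 0"
    by blast
  then show ?thesis by metis
qed

text \<open>If \<open>p = (X - a) q\<close> and \<open>p(A) v = 0\<close>, then \<open>v\<close> is an eigenvector or \<open>q(A)\<close> kills the nonzero
  vector \<open>A v - a v\<close>; now induct on the degree.\<close>
lemma eigenvector_of_annihilating_poly:
  assumes A: "module_hom scale scale A" and W: "subspace W" "\<And>w. w \<in> W \<Longrightarrow> A w \<in> W"
    and "v \<in> W" "v \<noteq> 0" "p \<noteq> 0" "degree p \<le> N" "(\<Sum>i\<le>N. coeff p i \<cdot> (A ^^ i) v) = 0"
  shows "\<exists>u\<in>W. \<exists>a. u \<noteq> 0 \<and> A u = a \<cdot> u"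
  using assms(4-)
proof (induction "degree p" arbitrary: p v)
  case 0
  have "(\<Sum>i\<in>{..N}. coeff p i \<cdot> (A ^^ i) v) = (\<Sum>i\<in>{0}. coeff p i \<cdot> (A ^^ i) v)"
    using 0 by (intro sum.mono_neutral_right) (auto simp: coeff_eq_0)
  then have "coeff p 0 \<cdot> v = 0" using 0 by simp
  moreover have "coeff p 0 \<noteq> 0" using 0 leading_coeff_0_iff by metis
  ultimately show ?case using 0 by simp
next
  case (Suc d)
  interpret A: module_hom scale scale A by fact
  have "\<not> constant (poly p)" using Suc(2) by (simp add: constant_degree)
  then obtain a where "poly p a = 0" using fundamental_theorem_of_algebra by blast
  then obtain q where q: "p = [:-a, 1:] * q" by (auto simp: poly_eq_0_iff_dvd)
  then have q0: "q \<noteq> 0" using Suc by auto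
  have dq: "degree p = Suc (degree q)" unfolding q using q0 by (subst degree_mult_eq) auto
  show ?case
  proof (cases "A v = a \<cdot> v")
    case True
    then show ?thesis using Suc by blast
  next
    case False
    obtain M where M: "N = Suc M" using Suc dq by (cases N) auto
    have pow: "(A ^^ i) (A v - a \<cdot> v) = (A ^^ Suc i) v - a \<cdot> (A ^^ i) v" for i
      by (induction i) (simp_all add: A.diff A.scale)
    have "(\<Sum>i\<le>N. coeff q i \<cdot> (A ^^ i) (A v - a \<cdot> v)) =
       (\<Sum>i\<le>N. coeff q i \<cdot> (A ^^ Suc i) v) - (\<Sum>i\<le>N. (a * coeff q i) \<cdot> (A ^^ i) v)"
      unfolding pow by (simp add: scale_right_diff_distrib sum_subtractf mult.commute)
    also have "(\<Sum>i\<le>N. coeff q i \<cdot> (A ^^ Suc i) v) = (\<Sum>i\<le>N. coeff (pCons 0 q) i \<cdot> (A ^^ i) v)"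
    proof -
      have "coeff q N = 0" using Suc dq by (intro coeff_eq_0) auto
      then have "(\<Sum>i\<le>N. coeff q i \<cdot> (A ^^ Suc i) v) = (\<Sum>i\<le>M. coeff q i \<cdot> (A ^^ Suc i) v)"
        by (simp add: M)
      also have "\<dots> = (\<Sum>i\<le>N. coeff (pCons 0 q) i \<cdot> (A ^^ i) v)"
        unfolding M sum.atMost_Suc_shift by (simp del: funpow.simps)
      finally show ?thesis .
    qed
    also have "\<dots> - (\<Sum>i\<le>N. (a * coeff q i) \<cdot> (A ^^ i) v) = (\<Sum>i\<le>N. coeff p i \<cdot> (A ^^ i) v)"
      by (simp add: q scale_left_diff_distrib sum_subtractf[symmetric])
    finally have "(\<Sum>i\<le>N. coeff q i \<cdot> (A ^^ i) (A v - a \<cdot> v)) = 0" using Suc by simp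
    with False show ?thesis
      using Suc dq q0 W by (intro Suc.hyps(1)[of q "A v - a \<cdot> v"]) 
        (auto intro: subspace_diff subspace_scale)
  qed
qed

lemma eigenvector_exists:
  assumes "module_hom scale scale A" "subspace W" "\<And>w. w \<in> W \<Longrightarrow> A w \<in> W"
    and "finite_span W" "W \<noteq> {0}"
  obtains u a where "u \<in> W" "u \<noteq> 0" "A u = a \<cdot> u"
proof -
  obtain v where v: "v \<in> W" "v \<noteq> 0" using assms subspace_0 by blast
  have inW: "(A ^^ i) v \<in> W" for i by (induction i) (auto simp: v assms)
  then obtain c N where c: "\<exists>i<N. c i \<noteq> 0" "(\<Sum>i<N. c i \<cdot> (A ^^ i) v) = 0"
    using relation_of_sequence[of W "\<lambda>i. (A ^^ i) v", OF assms(4) inW] by metis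
  define p where "p = (\<Sum>i<N. monom (c i) i)"
  have coeff_p: "coeff p i = (if i < N then c i else 0)" for i
    by (auto simp: p_def coeff_sum coeff_monom)
  have "p \<noteq> 0" using c(1) coeff_p by (metis coeff_0)
  moreover have "degree p \<le> N" by (intro degree_le) (simp add: coeff_p)
  moreover have "(\<Sum>i\<le>N. coeff p i \<cdot> (A ^^ i) v) = 0"
    using c(2) by (simp add: coeff_p lessThan_Suc_atMost[symmetric])
  ultimately show ?thesis
    using eigenvector_of_annihilating_poly[OF assms(1-3) v] that by blast
qed

lemma common_eigenvector_exists:
  assumes A: "module_hom scale scale A" and B: "module_hom scale scale B"
    and W: "subspace W" "\<And>w. w \<in> W \<Longrightarrow> A w \<in> W" "\<And>w. w \<in> W \<Longrightarrow> B w \<in> W"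
    and comm: "\<And>w. w \<in> W \<Longrightarrow> A (B w) = B (A w)"
    and fin: "finite_span W" "W \<noteq> {0}"
  obtains u a b where "u \<in> W" "u \<noteq> 0" "A u = a \<cdot> u" "B u = b \<cdot> u"
proof -
  interpret A: module_hom scale scale A by fact
  interpret B: module_hom scale scale B by fact
  obtain v a where v: "v \<in> W" "v \<noteq> 0" "A v = a \<cdot> v"
    using eigenvector_exists[OF A W(1,2) fin] by blast
  define E where "E = {w\<in>W. A w = a \<cdot> w}"
  have "subspace E"
    using W(1) by (auto simp: E_def subspace_def A.add A.scale scale_right_distrib mult.commute)
  moreover have "B w \<in> E" if "w \<in> E" for w
    using that W comm by (auto simp: E_def B.scale)
  moreover have "finite_span E" using fin(1) by (rule finite_span_subset) (auto simp: E_def)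
  moreover have "E \<noteq> {0}" using v by (auto simp: E_def)
  ultimately obtain u b where "u \<in> E" "u \<noteq> 0" "B u = b \<cdot> u"
    using eigenvector_exists[OF B] by metis
  with that show ?thesis by (auto simp: E_def)
qed

text \<open>Applying \<open>A - e j\<close> to a relation removes the term of index \<open>j\<close> and rescales the others by
  nonzero factors.\<close>
lemma eigenvectors_distinct_eigenvalues:
  assumes A: "module_hom scale scale A" and "inj_on e F"
    and "\<And>i. i \<in> F \<Longrightarrow> A (u i) = e i \<cdot> u i" "\<And>i. i \<in> F \<Longrightarrow> u i \<noteq> 0"
    and "finite F" "(\<Sum>i\<in>F. c i \<cdot> u i) = 0"
  shows "\<forall>i\<in>F. c i = 0"
  using assms(5,2-4,6)
proof (induction F arbitrary: c rule: finite_induct)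
  case empty
  then show ?case by simp
next
  case (insert j F)
  interpret A: module_hom scale scale A by fact
  have rel: "c j \<cdot> u j + (\<Sum>i\<in>F. c i \<cdot> u i) = 0" using insert by simp
  have "0 = A (c j \<cdot> u j + (\<Sum>i\<in>F. c i \<cdot> u i)) - e j \<cdot> (c j \<cdot> u j + (\<Sum>i\<in>F. c i \<cdot> u i))"
    by (simp add: rel)
  also have "\<dots> = (\<Sum>i\<in>F. (c i * e i) \<cdot> u i) - (\<Sum>i\<in>F. (e j * c i) \<cdot> u i)"
    using insert.prems
    by (simp add: A.add A.sum A.scale scale_right_distrib scale_sum_right mult.commute
        cong: sum.cong)
  also have "\<dots> = (\<Sum>i\<in>F. (c i * (e i - e j)) \<cdot> u i)"
    by (simp add: sum_subtractf scale_left_diff_distrib right_diff_distrib mult.commute)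
  finally have "\<forall>i\<in>F. c i * (e i - e j) = 0"
    using insert.prems by (intro insert.IH) auto
  moreover have "e i \<noteq> e j" if "i \<in> F" for i
    using insert that by (metis inj_on_def insertI1 insertI2)
  ultimately have "\<forall>i\<in>F. c i = 0" by simp
  with rel insert.prems show ?case by simp
qed

lemma no_infinite_eigenvalue_sequence:
  assumes A: "module_hom scale scale A" and "finite_span W" and e: "inj e"
    and u: "\<And>i::nat. u i \<in> W" "\<And>i. u i \<noteq> 0" "\<And>i. A (u i) = e i \<cdot> u i"
  shows False
proof -
  obtain c N where "\<exists>i<N. c i \<noteq> 0" "(\<Sum>i<N. c i \<cdot> u i) = 0"
    using relation_of_sequence[of W u, OF assms(2) u(1)] by metis
  moreover have "\<forall>i\<in>{..<N}. c i = 0"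
    using calculation e
    by (intro eigenvectors_distinct_eigenvalues[OF A, of e _ u]) (auto simp: u intro: inj_on_subset)
  ultimately show False by auto
qed

text \<open>\<open>B\<close> shifts eigenvalues of \<open>A\<close> by \<open>c\<close>: if \<open>A v = a v\<close>, then \<open>A (B\<^sup>k v) = (a + k c) B\<^sup>k v\<close>. Were \<open>B\<close>
  injective, this would give infinitely many eigenvalues.\<close>
lemma weight_operator_not_injective:
  assumes A: "module_hom scale scale A" and B: "module_hom scale scale B"
    and W: "subspace W" "\<And>w. w \<in> W \<Longrightarrow> A w \<in> W" "\<And>w. w \<in> W \<Longrightarrow> B w \<in> W"
    and fin: "finite_span W" "W \<noteq> {0}"
    and comm: "\<And>w. w \<in> W \<Longrightarrow> A (B w) - B (A w) = c \<cdot> B w" and "c \<noteq> 0"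
  obtains w where "w \<in> W" "w \<noteq> 0" "B w = 0"
proof (rule ccontr)
  interpret A: module_hom scale scale A by fact
  interpret B: module_hom scale scale B by fact
  assume "\<not> thesis"
  then have inj: "\<And>w. w \<in> W \<Longrightarrow> w \<noteq> 0 \<Longrightarrow> B w \<noteq> 0" using that by blast
  obtain v a where v: "v \<in> W" "v \<noteq> 0" "A v = a \<cdot> v"
    using eigenvector_exists[OF A W(1,2) fin] by blast
  have u: "(B ^^ i) v \<in> W \<and> (B ^^ i) v \<noteq> 0 \<and> A ((B ^^ i) v) = (a + of_nat i * c) \<cdot> (B ^^ i) v"
    for i
  proof (induction i)
    case 0
    then show ?case using v by simp
  next
    case (Suc i)
    then have "A (B ((B ^^ i) v)) = B (A ((B ^^ i) v)) + c \<cdot> B ((B ^^ i) v)"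
      using comm by (metis diff_add_cancel add.commute)
    with Suc show ?case using W inj by (simp add: B.scale scale_left_distrib[symmetric]
          add.commute add.left_commute distrib_right)
  qed
  show False
  proof (rule no_infinite_eigenvalue_sequence[OF A fin(1), of "\<lambda>i. a + of_nat i * c" "\<lambda>i. (B ^^ i) v"])
    show "inj (\<lambda>i::nat. a + of_nat i * c)" using \<open>c \<noteq> 0\<close> by (auto simp: inj_on_def)
  qed (use u in auto)
qed

text \<open>A trace argument in disguise: on an eigenspace of \<open>C\<close> the relation reads \<open>[A, B] = c\<close>. If
  \<open>A v = a v\<close> and \<open>c \<noteq> 0\<close>, then \<open>A - a\<close> and \<open>B\<close> act on the vectors \<open>B\<^sup>k v\<close> like annihilation and
  creation operators, and \<open>B (A - a)\<close> has the infinitely many eigenvalues \<open>k c\<close>.\<close>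
lemma no_canonical_commutation:
  assumes A: "module_hom scale scale A" and B: "module_hom scale scale B"
    and C: "module_hom scale scale C"
    and W: "subspace W" "\<And>w. w \<in> W \<Longrightarrow> A w \<in> W" "\<And>w. w \<in> W \<Longrightarrow> B w \<in> W"
      "\<And>w. w \<in> W \<Longrightarrow> C w \<in> W"
    and fin: "finite_span W" "W \<noteq> {0}"
    and comm: "\<And>w. w \<in> W \<Longrightarrow> A (B w) - B (A w) = C w"
      "\<And>w. w \<in> W \<Longrightarrow> A (C w) = C (A w)" "\<And>w. w \<in> W \<Longrightarrow> B (C w) = C (B w)"
  obtains w where "w \<in> W" "w \<noteq> 0" "C w = 0"
proof -
  interpret A: module_hom scale scale A by fact
  interpret B: module_hom scale scale B by fact
  interpret C: module_hom scale scale C by fact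
  obtain v a c where v: "v \<in> W" "v \<noteq> 0" "A v = a \<cdot> v" "C v = c \<cdot> v"
    using common_eigenvector_exists[OF A C W(1,2,4) comm(2) fin] by blast
  have "c = 0"
  proof (rule ccontr)
    assume "c \<noteq> 0"
    define D where "D w = A w - a \<cdot> w" for w
    have D: "module_hom scale scale D"
      by unfold_locales
        (simp_all add: D_def A.add A.scale scale_right_distrib scale_right_diff_distrib mult.commute)
    have BD: "module_hom scale scale (\<lambda>w. B (D w))"
      using module_hom_compose[OF D B] by (simp add: o_def)
    have DB: "D (B w) = B (D w) + C w" if "w \<in> W" for w
      using comm(1)[OF that] by (simp add: D_def B.diff B.scale algebra_simps)
    have u: "(B ^^ i) v \<in> W \<and> C ((B ^^ i) v) = c \<cdot> (B ^^ i) v \<and>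
        B (D ((B ^^ i) v)) = (of_nat i * c) \<cdot> (B ^^ i) v" for i
    proof (induction i)
      case 0
      then show ?case using v by (simp add: D_def)
    next
      case (Suc i)
      then show ?case using W
        by (simp add: DB comm(3)[symmetric] B.scale B.add scale_left_distrib algebra_simps)
    qed
    have nz: "(B ^^ i) v \<noteq> 0" for i
    proof (induction i)
      case 0
      then show ?case using v by simp
    next
      case (Suc i)
      have "D ((B ^^ Suc i) v) = (of_nat (Suc i) * c) \<cdot> (B ^^ i) v"
        using u[of i] by (simp add: DB scale_left_distrib distrib_right add.commute)
      moreover have "D 0 = 0" by (simp add: D_def)
      ultimately show ?case using Suc \<open>c \<noteq> 0\<close> by (metis mult_eq_0_iff of_nat_eq_0_iff nat.distinct(1) scale_eq_0_iff)
    qed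
    show False
    proof (rule no_infinite_eigenvalue_sequence[OF BD fin(1), of "\<lambda>i. of_nat i * c" "\<lambda>i. (B ^^ i) v"])
      show "inj (\<lambda>i::nat. of_nat i * c)" using \<open>c \<noteq> 0\<close> by (auto simp: inj_on_def)
    qed (use u nz in auto)
  qed
  with v that show ?thesis by simp
qed

end

section \<open>Degrees in \<open>\<lambda>\<close> of a sesquilinear action\<close>

lemma scale_pCons:
  fixes s :: "complex poly \<Rightarrow> 'w::ab_group_add \<Rightarrow> 'w"
  assumes "module s"
  shows "s (pCons c p) v = s [:c:] v + s del (s p v)"
proof -
  interpret s: module s by fact
  have "pCons c p = [:c:] + del * p" by simp
  then show ?thesis by (simp only: s.scale_left_distrib s.scale_scale)
qed

lemma subspace_if_del_closed:
  fixes s :: "complex poly \<Rightarrow> 'w::ab_group_add \<Rightarrow> 'w"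
  assumes "module s" and zero: "0 \<in> U" and add: "\<And>x y. x \<in> U \<Longrightarrow> y \<in> U \<Longrightarrow> x + y \<in> U"
    and scale: "\<And>c x. x \<in> U \<Longrightarrow> s [:c:] x \<in> U" and del: "\<And>x. x \<in> U \<Longrightarrow> s del x \<in> U"
  shows "module.subspace s U"
proof -
  interpret s: module s by fact
  have "s p x \<in> U" if "x \<in> U" for p x
  proof (induction p)
    case 0
    show ?case by (simp add: zero)
  next
    case (pCons c p)
    then show ?case
      unfolding scale_pCons[OF \<open>module s\<close>, of c p] using that by (intro add scale del)
  qed
  then show ?thesis using zero add by (simp add: s.subspace_def)
qed

lemma complex_vector_space_of_module:
  fixes s :: "complex poly \<Rightarrow> 'w::ab_group_add \<Rightarrow> 'w"
  assumes "module s"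
  shows "complex_vector_space (\<lambda>c. s [:c:])"
proof -
  interpret s: module s by fact
  have "s [:c + d:] x = s [:c:] x + s [:d:] x" for c d x
    by (metis s.scale_left_distrib add_pCons add_0)
  moreover have "s [:c:] (s [:d:] x) = s [:c * d:] x" for c d x
    by (simp add: mult.commute)
  moreover have "s [:1:] x = x" for x
    by (metis one_pCons s.scale_one)
  ultimately show ?thesis
    by unfold_locales (simp_all add: s.scale_right_distrib)
qed

context sesquilinear_action
begin

sublocale C: complex_vector_space "\<lambda>c. sV [:c:]"
  using V.module_axioms by (rule complex_vector_space_of_module)

lemma act_zero [simp]: "act a 0 = 0"
  using add_right[of a 0 0] by simp

lemma act_sum: "act a (\<Sum>x\<in>S. f x) = (\<Sum>x\<in>S. act a (f x))"
  by (induction S rule: infinite_finite_induct) (simp_all add: add_right)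

lemma coeff_act_scale_right: "coeff (act a (sV [:c:] v)) n = sV [:c:] (coeff (act a v) n)"
  by (simp add: scale_right coeff_map_poly)

lemma coeff_act_scale_left: "coeff (act (sR [:c:] a) v) n = sV [:c:] (coeff (act a v) n)"
  by (simp add: scale_left coeff_map_poly)

lemma coeff_act_del_right:
  "coeff (act a (sV del v)) n =
    sV del (coeff (act a v) n) + (case n of 0 \<Rightarrow> 0 | Suc k \<Rightarrow> coeff (act a v) k)"
  by (simp add: del_right coeff_map_poly coeff_pCons)

lemma coeff_act_del_left:
  "coeff (act (sR del a) v) n = (case n of 0 \<Rightarrow> 0 | Suc k \<Rightarrow> - coeff (act a v) k)"
  by (simp add: del_left coeff_pCons split: nat.split)

lemma coeff_act_linear: "module_hom (\<lambda>c. sV [:c:]) (\<lambda>c. sV [:c:]) (\<lambda>v. coeff (act a v) n)"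
  by unfold_locales (simp_all add: add_right coeff_act_scale_right)

text \<open>The top coefficient in \<open>\<lambda>\<close> of \<open>p(\<partial> + \<lambda>) a\<^sub>\<lambda> v\<close>. The bounds \<open>n\<close> and \<open>k\<close> need not be the exact degrees,
  so that the lemma applies uniformly to all terms of a relation.\<close>
lemma leading_coeff_act_scale:
  assumes "\<And>j. j > n \<Longrightarrow> coeff (act a v) j = 0" and "degree p \<le> k"
  shows "(\<forall>j>n + k. coeff (act a (sV p v)) j = 0) \<and>
    coeff (act a (sV p v)) (n + k) = sV [:coeff p k:] (coeff (act a v) n)"
  using assms(2)
proof (induction p arbitrary: k)
  case 0
  then show ?case by simp
next
  case (pCons c p)
  note expand = scale_pCons[OF V.module_axioms, of c p v]
  show ?case
  proof (cases k)
    case 0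
    then have "p = 0" using pCons by (auto split: if_splits)
    with 0 show ?thesis using assms(1) by (simp add: coeff_act_scale_right)
  next
    case (Suc k')
    then have "degree p \<le> k'" using pCons.prems by (auto split: if_splits)
    from pCons.IH[OF this]
    have IH: "\<And>j. j > n + k' \<Longrightarrow> coeff (act a (sV p v)) j = 0"
      "coeff (act a (sV p v)) (n + k') = sV [:coeff p k':] (coeff (act a v) n)"
      by auto
    show ?thesis
      unfolding expand
      by (auto simp: Suc add_right coeff_act_scale_right coeff_act_del_right assms(1) IH
          simp del: V.scale_scale split: nat.split)
  qed
qed

text \<open>The source of all finiteness. Lift more independent coefficients than there are generators to
  elements of \<open>W\<close>: these satisfy a relation over \<open>\<complex>[\<partial>]\<close>, and the top coefficient of the action of \<open>a\<close>
  on it is a relation over \<open>\<complex>\<close> between the chosen coefficients.\<close>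
lemma rank_bounds_leading_coeffs:
  assumes fin: "finite S" "V.span S = UNIV"
    and W: "\<And>w j. w \<in> W \<Longrightarrow> j > n \<Longrightarrow> coeff (act a w) j = 0"
    and B: "B \<subseteq> (\<lambda>w. coeff (act a w) n) ` W" "C.independent B"
  shows "finite B"
proof (rule ccontr)
  assume "infinite B"
  then obtain B0 where B0: "B0 \<subseteq> B" "finite B0" "card B0 = Suc (card S)"
    using infinite_arbitrarily_large by blast
  have "\<forall>b\<in>B0. \<exists>w\<in>W. coeff (act a w) n = b" using B B0 by blast
  then obtain w where w: "\<And>b. b \<in> B0 \<Longrightarrow> w b \<in> W" "\<And>b. b \<in> B0 \<Longrightarrow> coeff (act a (w b)) n = b"
    by metis
  have "\<exists>p. (\<exists>b\<in>B0. p b \<noteq> 0) \<and> (\<Sum>b\<in>B0. sV (p b) (w b)) = 0"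
    using fin B0 by (intro nontrivial_relation_in_span[where S=S]) (auto intro: V.module_axioms)
  then obtain p b0 where p: "b0 \<in> B0" "p b0 \<noteq> 0" "(\<Sum>b\<in>B0. sV (p b) (w b)) = 0" by blast
  define k where "k = Max ((\<lambda>b. degree (p b)) ` {b\<in>B0. p b \<noteq> 0})"
  have fin': "finite ((\<lambda>b. degree (p b)) ` {b\<in>B0. p b \<noteq> 0})" using B0 by simp
  have k: "degree (p b) \<le> k" if "b \<in> B0" for b
    using Max_ge[OF fin', of "degree (p b)"] that by (cases "p b = 0") (auto simp: k_def)
  have "k \<in> (\<lambda>b. degree (p b)) ` {b\<in>B0. p b \<noteq> 0}"
    unfolding k_def using p fin' by (intro Max_in) auto
  then obtain b1 where b1: "b1 \<in> B0" "p b1 \<noteq> 0" "degree (p b1) = k" by blast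
  have "0 = coeff (act a (\<Sum>b\<in>B0. sV (p b) (w b))) (n + k)" by (simp add: p)
  also have "\<dots> = (\<Sum>b\<in>B0. coeff (act a (sV (p b) (w b))) (n + k))"
    by (simp add: act_sum coeff_sum)
  also have "\<dots> = (\<Sum>b\<in>B0. sV [:coeff (p b) k:] b)"
    using leading_coeff_act_scale[of n a] W w k by (intro sum.cong) auto
  finally have "coeff (p b1) k = 0"
    using C.independentD[OF B(2) B0(2,1)] b1(1) by metis
  with b1 show False by (metis leading_coeff_0_iff)
qed

lemma torsion_free:
  assumes "act a v \<noteq> 0" "sV p v = 0"
  shows "p = 0"
proof -
  have "coeff (act a (sV p v)) (degree (act a v) + degree p) =
      sV [:lead_coeff p:] (lead_coeff (act a v))"
    by (intro conjunct2[OF leading_coeff_act_scale]) (auto simp: coeff_eq_0)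
  with assms have "sV [:lead_coeff p:] (lead_coeff (act a v)) = 0" by simp
  with assms(1) have "lead_coeff p = 0" by (metis C.scale_eq_0_iff leading_coeff_0_iff)
  then show ?thesis by simp
qed

end

section \<open>Commutation relations of the coefficient operators\<close>

locale R_module =
  algebra_R sR br L I + conformal_module sR br sV act
  for sR :: "complex poly \<Rightarrow> 'r::ab_group_add \<Rightarrow> 'r" and br :: "'r \<Rightarrow> 'r \<Rightarrow> 'r poly"
    and L I :: 'r
    and sV :: "complex poly \<Rightarrow> 'v::ab_group_add \<Rightarrow> 'v" and act :: "'r \<Rightarrow> 'v \<Rightarrow> 'v poly"
begin

definition L_coeff :: "nat \<Rightarrow> 'v \<Rightarrow> 'v" where "L_coeff n v = coeff (act L v) n"
definition I_coeff :: "nat \<Rightarrow> 'v \<Rightarrow> 'v" where "I_coeff n v = coeff (act I v) n"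

lemma L_coeff_linear: "module_hom (\<lambda>c. sV [:c:]) (\<lambda>c. sV [:c:]) (L_coeff n)"
  unfolding L_coeff_def by (rule M.coeff_act_linear)

lemma I_coeff_linear: "module_hom (\<lambda>c. sV [:c:]) (\<lambda>c. sV [:c:]) (I_coeff n)"
  unfolding I_coeff_def by (rule M.coeff_act_linear)

sublocale L_coeff: module_hom "\<lambda>c. sV [:c:]" "\<lambda>c. sV [:c:]" "L_coeff n" for n by (rule L_coeff_linear)
sublocale I_coeff: module_hom "\<lambda>c. sV [:c:]" "\<lambda>c. sV [:c:]" "I_coeff n" for n by (rule I_coeff_linear)

lemma L_coeff_del:
  "L_coeff n (sV del v) = sV del (L_coeff n v) + (case n of 0 \<Rightarrow> 0 | Suc k \<Rightarrow> L_coeff k v)"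
  unfolding L_coeff_def by (rule M.coeff_act_del_right)

lemma I_coeff_del:
  "I_coeff n (sV del v) = sV del (I_coeff n v) + (case n of 0 \<Rightarrow> 0 | Suc k \<Rightarrow> I_coeff k v)"
  unfolding I_coeff_def by (rule M.coeff_act_del_right)

text \<open>All brackets of generators have the form \<open>(p(\<partial>) + \<lambda> q(\<partial>)) c\<close>, so only two terms of the sum in the
  commutator identity survive.\<close>
lemma commutator_linear_bracket:
  assumes "br a b = lam_scale sR [:p, q:] c"
  shows "coeff (act a (coeff (act b v) n)) m - coeff (act b (coeff (act a v) m)) n =
    coeff_sum_subst sV (act (sR p c) v) m n +
    (case m of 0 \<Rightarrow> 0 | Suc k \<Rightarrow> coeff_sum_subst sV (act (sR q c) v) k n)"
proof -
  have act0: "act 0 v = 0" using M.add_left[of 0 0 v] by simp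
  have br: "coeff (br a b) j = (if j = 0 then sR p c else if j = 1 then sR q c else 0)" for j
    unfolding assms lam_scale_def
    by (auto simp: coeff_map_poly coeff_pCons split: nat.split)
  have "coeff (act a (coeff (act b v) n)) m - coeff (act b (coeff (act a v) m)) n =
      (\<Sum>j\<le>m. coeff_sum_subst sV (act (coeff (br a b) j) v) (m - j) n)"
    using commutator unfolding commutator_identity_def by blast
  also have "\<dots> = (\<Sum>j\<in>{..m} \<inter> {0, 1}. coeff_sum_subst sV (act (coeff (br a b) j) v) (m - j) n)"
    by (intro sum.mono_neutral_right) (auto simp: br act0 coeff_sum_subst_def)
  also have "\<dots> = coeff_sum_subst sV (act (sR p c) v) m n +
    (case m of 0 \<Rightarrow> 0 | Suc k \<Rightarrow> coeff_sum_subst sV (act (sR q c) v) k n)"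
    by (cases m) (auto simp: br)
  finally show ?thesis .
qed

lemma I_I_commute: "I_coeff m (I_coeff n v) = I_coeff n (I_coeff m v)"
proof -
  have "br I I = lam_scale sR [:0, 0:] I" by (simp add: bracket_II lam_scale_def)
  from commutator_linear_bracket[OF this, of v n m] show ?thesis
    using M.add_left[of 0 0 v] by (simp add: I_coeff_def coeff_sum_subst_def split: nat.splits)
qed

lemma L_I_0_commute: "L_coeff m (I_coeff 0 v) = I_coeff 0 (L_coeff m v)"
  using commutator_linear_bracket[OF bracket_LI, of v 0 m]
  by (cases m) (simp_all add: L_coeff_def I_coeff_def coeff_sum_subst_def M.coeff_act_del_left
      one_pCons M.coeff_act_scale_left)

lemma L_I_Suc_commutator:
  "L_coeff m (I_coeff (Suc n) v) - I_coeff (Suc n) (L_coeff m v) =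
    - sV [:of_nat ((m + n) choose m):] (I_coeff (m + n) v)"
proof (cases m)
  case 0
  then show ?thesis
    using commutator_linear_bracket[OF bracket_LI, of v "Suc n" m]
    by (simp add: L_coeff_def I_coeff_def coeff_sum_subst_def M.coeff_act_del_left)
next
  case (Suc k)
  have "coeff (act (sR [:1:] I) v) (k + Suc n) = I_coeff (k + Suc n) v"
    by (simp add: I_coeff_def)
  then have "L_coeff m (I_coeff (Suc n) v) - I_coeff (Suc n) (L_coeff m v) =
      - sV [:of_nat ((Suc (k + Suc n)) choose Suc k):] (I_coeff (k + Suc n) v)
      + sV [:of_nat ((k + Suc n) choose k):] (I_coeff (k + Suc n) v)"
    using commutator_linear_bracket[OF bracket_LI, of v "Suc n" m] Suc
    by (simp add: L_coeff_def I_coeff_def coeff_sum_subst_def M.coeff_act_del_left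
        of_nat_poly one_pCons del: binomial_Suc_Suc)
  also have "\<dots> = - sV [:of_nat ((k + Suc n) choose Suc k):] (I_coeff (k + Suc n) v)"
    by (simp add: M.C.scale_left_distrib)
  finally show ?thesis using Suc by simp
qed

definition LI_coeff :: "nat \<Rightarrow> 'v \<Rightarrow> 'v" where "LI_coeff n v = L_coeff n v + I_coeff n v"

lemma L_0_L_commutator:
  "L_coeff 0 (L_coeff (Suc n) v) - L_coeff (Suc n) (L_coeff 0 v) = - LI_coeff n v"
  using commutator_linear_bracket[OF bracket_LL, of v "Suc n" 0]
  by (simp add: L_coeff_def I_coeff_def LI_coeff_def coeff_sum_subst_def M.coeff_act_del_left M.add_left)

lemma L_L_commutator:
  "L_coeff (Suc m) (L_coeff n v) - L_coeff n (L_coeff (Suc m) v) =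
    sV [:2 * of_nat ((m + n) choose m) - of_nat (Suc (m + n) choose Suc m):] (LI_coeff (m + n) v)"
proof -
  have two: "coeff (act (sR 2 (L + I)) v) (m + n) = sV [:2:] (LI_coeff (m + n) v)"
    by (simp add: numeral_poly M.coeff_act_scale_left LI_coeff_def L_coeff_def I_coeff_def M.add_left)
  have "L_coeff (Suc m) (L_coeff n v) - L_coeff n (L_coeff (Suc m) v) =
     - sV [:of_nat (Suc (m + n) choose Suc m):] (LI_coeff (m + n) v)
     + sV [:of_nat ((m + n) choose m):] (sV [:2:] (LI_coeff (m + n) v))"
    using commutator_linear_bracket[OF bracket_LL, of v n "Suc m"]
    by (simp add: L_coeff_def[symmetric] coeff_sum_subst_def two M.coeff_act_del_left
        of_nat_poly del: binomial_Suc_Suc M.V.scale_scale)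
      (simp add: LI_coeff_def L_coeff_def I_coeff_def M.add_left)
  then show ?thesis
    unfolding M.C.scale_left_diff_distrib by (simp add: mult.commute del: binomial_Suc_Suc)
qed

lemma L_1_I_commutator:
  "L_coeff (Suc 0) (I_coeff n v) - I_coeff n (L_coeff (Suc 0) v) = sV [:- of_nat n:] (I_coeff n v)"
proof (cases n)
  case 0
  then show ?thesis by (simp add: L_I_0_commute)
next
  case (Suc k)
  then show ?thesis using L_I_Suc_commutator[of "Suc 0" k v] M.C.scale_minus_left[of "of_nat n" "I_coeff n v"]
    by simp
qed

lemma L_1_L_commutator:
  "L_coeff (Suc 0) (L_coeff n v) - L_coeff n (L_coeff (Suc 0) v) = sV [:1 - of_nat n:] (LI_coeff n v)"
  using L_L_commutator[of 0 n v] by simp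

text \<open>
  In a module over the Virasoro conformal algebra, \<open>\<partial> - L\<^sub>0\<close> commutes with the whole action. Here it
  fails to do so exactly by \<open>I\<close>: \<open>[D, L\<^bsub>n+1\<^esub>] = I\<^sub>n\<close>. As \<open>L\<^sub>0 = \<partial> - D\<close>, an eigenvector of \<open>D\<close> is a
  vector on which \<open>L\<^sub>0\<close> acts as \<open>\<partial> + \<alpha>\<close>.
\<close>
definition D :: "'v \<Rightarrow> 'v" where "D v = sV del v - L_coeff 0 v"

lemma D_linear: "module_hom (\<lambda>c. sV [:c:]) (\<lambda>c. sV [:c:]) D"
  by unfold_locales
    (simp_all add: D_def M.V.scale_right_distrib M.V.scale_right_diff_distrib L_coeff.add L_coeff.scale mult.commute)

sublocale D: module_hom "\<lambda>c. sV [:c:]" "\<lambda>c. sV [:c:]" D by (rule D_linear)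

lemma D_I_commute: "D (I_coeff n v) = I_coeff n (D v)"
proof (cases n)
  case 0
  then show ?thesis by (simp add: D_def I_coeff.diff I_coeff_del L_I_0_commute)
next
  case (Suc k)
  then show ?thesis using L_I_Suc_commutator[of 0 k v]
    by (simp add: D_def I_coeff.diff I_coeff_del algebra_simps)
qed

lemma D_L_commutator: "D (L_coeff (Suc n) v) = L_coeff (Suc n) (D v) + I_coeff n v"
  using L_0_L_commutator[of n v] by (simp add: D_def L_coeff.diff L_coeff_del LI_coeff_def algebra_simps)

section \<open>Vectors on which the action has bounded degree\<close>

definition Trunc :: "nat \<Rightarrow> nat \<Rightarrow> 'v set" where
  "Trunc N M = {v. (\<forall>n\<ge>N. L_coeff n v = 0) \<and> (\<forall>n\<ge>M. I_coeff n v = 0)}"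

lemma Trunc_subspace: "M.C.subspace (Trunc N M)"
  unfolding M.C.subspace_def by (simp add: Trunc_def L_coeff.add I_coeff.add L_coeff.scale I_coeff.scale)

lemma Trunc_SucD_L: "v \<in> Trunc (Suc N) M \<Longrightarrow> L_coeff N v = 0 \<Longrightarrow> v \<in> Trunc N M"
  by (simp add: Trunc_def) (metis Suc_leI le_neq_implies_less)

lemma Trunc_SucD_I: "v \<in> Trunc N (Suc M) \<Longrightarrow> I_coeff M v = 0 \<Longrightarrow> v \<in> Trunc N M"
  by (simp add: Trunc_def) (metis Suc_leI le_neq_implies_less)

text \<open>
  The commutators of indices \<open>m\<close> and \<open>n\<close> involve the index \<open>m + n - 1\<close> only. The side conditions below
  keep that index within the range where the operators vanish.
\<close>
lemma Trunc_L_1: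
  assumes "v \<in> Trunc N M" "M \<le> N"
  shows "L_coeff (Suc 0) v \<in> Trunc N M"
proof -
  have "L_coeff n (L_coeff (Suc 0) v) = 0" if "n \<ge> N" for n
    using L_1_L_commutator[of n v] assms that by (simp add: Trunc_def LI_coeff_def)
  moreover have "I_coeff n (L_coeff (Suc 0) v) = 0" if "n \<ge> M" for n
    using L_1_I_commutator[of n v] assms that by (simp add: Trunc_def)
  ultimately show ?thesis by (simp add: Trunc_def)
qed

lemma Trunc_I_0: "v \<in> Trunc N M \<Longrightarrow> I_coeff 0 v \<in> Trunc N M"
  by (simp add: Trunc_def L_I_0_commute I_I_commute[of _ 0])

lemma Trunc_I_Suc:
  assumes "v \<in> Trunc N M" "M \<le> N + k"
  shows "I_coeff (Suc k) v \<in> Trunc N M"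
proof -
  have "L_coeff n (I_coeff (Suc k) v) = 0" if "n \<ge> N" for n
    using L_I_Suc_commutator[of n k v] assms that by (simp add: Trunc_def)
  moreover have "I_coeff n (I_coeff (Suc k) v) = 0" if "n \<ge> M" for n
    using I_I_commute[of n "Suc k" v] assms that by (simp add: Trunc_def)
  ultimately show ?thesis by (simp add: Trunc_def)
qed

lemma Trunc_L_Suc:
  assumes "v \<in> Trunc N 0" "0 < k"
  shows "L_coeff (Suc k) v \<in> Trunc N 0"
proof -
  have "L_coeff n (L_coeff (Suc k) v) = 0" if "n \<ge> N" for n
    using L_L_commutator[of k n v] assms that by (simp add: Trunc_def LI_coeff_def)
  moreover have "I_coeff n (L_coeff (Suc k) v) = 0" for n
    using L_I_Suc_commutator[of "Suc k" "n - 1" v] L_I_0_commute[of "Suc k" v] assms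
    by (cases n) (simp_all add: Trunc_def)
  ultimately show ?thesis by (simp add: Trunc_def)
qed

lemma Trunc_D:
  assumes "v \<in> Trunc N M" "M < N"
  shows "D v \<in> Trunc N M"
proof -
  have "L_coeff n (D v) = 0" if "n \<ge> N" for n
    using D_L_commutator[of "n - 1" v] assms that by (cases n) (simp_all add: Trunc_def)
  moreover have "I_coeff n (D v) = 0" if "n \<ge> M" for n
    using D_I_commute[of n v] assms that by (simp add: Trunc_def)
  ultimately show ?thesis by (simp add: Trunc_def)
qed

text \<open>The elements \<open>a\<close> with all coefficients of \<open>a\<^sub>\<lambda> v\<close> in \<open>U\<close> form a \<open>\<complex>[\<partial>]\<close>-submodule, as
  \<open>(\<partial> a)\<^sub>\<lambda> = - \<lambda> a\<^sub>\<lambda>\<close>. So it suffices to test the generators.\<close>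
lemma act_in_subspace:
  assumes U: "M.V.subspace U" and "\<And>n. L_coeff n v \<in> U" "\<And>n. I_coeff n v \<in> U"
  shows "coeff (act a v) n \<in> U"
proof -
  define S where "S = {a. \<forall>n. coeff (act a v) n \<in> U}"
  have "act 0 v = 0" using M.add_left[of 0 0 v] by simp
  then have "R.subspace S"
    using U M.V.subspace_neg[OF U]
    by (intro subspace_if_del_closed[OF R.module_axioms])
      (auto simp: S_def M.add_left M.coeff_act_scale_left M.coeff_act_del_left
        M.V.subspace_def split: nat.split)
  moreover have "{L, I} \<subseteq> S" using assms by (auto simp: S_def L_coeff_def I_coeff_def)
  ultimately have "R.span {L, I} \<subseteq> S" using R.span_minimal by blast
  then show ?thesis using span_LI by (auto simp: S_def)
qed

end

section \<open>Finite nontrivial irreducible modules\<close>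

locale irreducible_R_module = R_module +
  assumes finitely_generated: "finite_module sV"
    and nontrivial: "\<not> trivial_action act"
    and irreducible: "irreducible_module sV act"
begin

text \<open>The vectors killed by the whole algebra form a submodule, proper by nontriviality.\<close>
lemma act_nonzero:
  assumes "v \<noteq> 0"
  shows "\<exists>a. act a v \<noteq> 0"
proof (rule ccontr)
  define U where "U = {v. \<forall>a. act a v = 0}"
  have "M.V.subspace U"
    by (intro subspace_if_del_closed[OF M.V.module_axioms])
      (auto simp: U_def M.add_right M.scale_right M.del_right)
  then have "conformal_submodule sV act U"
    by (auto simp: conformal_submodule_def U_def)
  then have "U = {0} \<or> U = UNIV" using irreducible by (simp add: irreducible_module_def)
  moreover have "U \<noteq> UNIV" using nontrivial by (auto simp: U_def trivial_action_def)
  moreover assume "\<nexists>a. act a v \<noteq> 0"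
  then have "v \<in> U" by (simp add: U_def)
  ultimately show False using \<open>v \<noteq> 0\<close> by simp
qed

lemma zero_if_annihilated:
  assumes "\<And>n. L_coeff n v = 0" "\<And>n. I_coeff n v = 0"
  shows "v = 0"
proof (rule ccontr)
  assume "v \<noteq> 0"
  then obtain a where "act a v \<noteq> 0" using act_nonzero by blast
  moreover have "coeff (act a v) n \<in> {0}" for n
    by (intro act_in_subspace) (simp_all add: assms)
  ultimately show False by (simp add: poly_eq_iff)
qed

text \<open>Passing from \<open>Trunc N M\<close> to \<open>Trunc (N + 1) M\<close> or \<open>Trunc N (M + 1)\<close> frees one top coefficient, whose
  possible values span a finite-dimensional space. Freeing one coefficient of one generator at a time
  avoids working in \<open>V \<times> V\<close>.\<close>
lemma finite_span_Trunc: "M.C.finite_span (Trunc N M)"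
proof -
  obtain S where S: "finite S" "M.V.span S = UNIV"
    using finitely_generated unfolding finite_module_def by blast
  have finite_Trunc_0: "M.C.finite_span (Trunc N 0)" for N
  proof (induction N)
    case 0
    have "Trunc 0 0 \<subseteq> M.C.span {}" using zero_if_annihilated by (auto simp: Trunc_def)
    then show ?case unfolding M.C.finite_span_def by blast
  next
    case (Suc N)
    show ?case
    proof (rule M.C.finite_span_if_kernel_image[OF L_coeff_linear[of N] Trunc_subspace])
      show "M.C.finite_span {w \<in> Trunc (Suc N) 0. L_coeff N w = 0}"
        by (rule M.C.finite_span_subset[OF Suc]) (auto intro: Trunc_SucD_L)
      show "finite B" if "B \<subseteq> L_coeff N ` Trunc (Suc N) 0" "M.C.independent B" for B
        by (rule M.rank_bounds_leading_coeffs[OF S _ that(1)[unfolded L_coeff_def] that(2)])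
          (simp add: Trunc_def L_coeff_def)
    qed
  qed
  show ?thesis
  proof (induction M)
    case (Suc M)
    show ?case
    proof (rule M.C.finite_span_if_kernel_image[OF I_coeff_linear[of M] Trunc_subspace])
      show "M.C.finite_span {w \<in> Trunc N (Suc M). I_coeff M w = 0}"
        by (rule M.C.finite_span_subset[OF Suc]) (auto intro: Trunc_SucD_I)
      show "finite B" if "B \<subseteq> I_coeff M ` Trunc N (Suc M)" "M.C.independent B" for B
        by (rule M.rank_bounds_leading_coeffs[OF S _ that(1)[unfolded I_coeff_def] that(2)])
          (simp add: Trunc_def I_coeff_def)
    qed
  qed (rule finite_Trunc_0)
qed

text \<open>With \<open>N \<ge> 2\<close>, the space \<open>Trunc N 1\<close> is preserved by \<open>D\<close>, and \<open>Trunc N M\<close> by \<open>I\<^bsub>M-1\<^esub>\<close>.\<close>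
lemma Trunc_nonzero: obtains N where "2 \<le> N" "Trunc N N \<noteq> {0}"
proof -
  obtain a v where "act a v \<noteq> 0" using nontrivial unfolding trivial_action_def by blast
  then have "v \<noteq> 0" by auto
  define N where "N = degree (act L v) + degree (act I v) + 2"
  have "v \<in> Trunc N N" by (auto simp: Trunc_def N_def L_coeff_def I_coeff_def intro!: coeff_eq_0)
  with \<open>v \<noteq> 0\<close> that[of N] show ?thesis by (auto simp: N_def)
qed

text \<open>The kernel \<open>U\<close> of the action of \<open>I\<close> is a submodule because \<open>I\<close> spans an ideal. That \<open>U \<noteq> 0\<close> is shown
  by minimality of \<open>M\<close>: a vector of \<open>Trunc N M\<close> in the kernel of \<open>I\<^bsub>M-1\<^esub>\<close> would lie in the zero space
  \<open>Trunc N (M - 1)\<close>.\<close>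
lemma I_acts_zero: "I_coeff n v = 0"
proof -
  define U where "U = {v. \<forall>n. I_coeff n v = 0}"
  have U: "M.V.subspace U"
    by (intro subspace_if_del_closed[OF M.V.module_axioms])
      (auto simp: U_def I_coeff.add I_coeff.scale I_coeff_del split: nat.split)
  have "L_coeff n u \<in> U" if "u \<in> U" for n u
  proof -
    have "I_coeff m (L_coeff n u) = 0" for m
      using L_I_Suc_commutator[of n "m - 1" u] L_I_0_commute[of n u] that
      by (cases m) (simp_all add: U_def)
    then show ?thesis by (simp add: U_def)
  qed
  moreover have "I_coeff n u \<in> U" if "u \<in> U" for n u using that U M.V.subspace_0 by (simp add: U_def)
  ultimately have "conformal_submodule sV act U"
    using U act_in_subspace[OF U] by (simp add: conformal_submodule_def)
  then have "U = {0} \<or> U = UNIV" using irreducible by (simp add: irreducible_module_def)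
  moreover have "U \<noteq> {0}"
  proof -
    obtain N where N: "2 \<le> N" "Trunc N N \<noteq> {0}" by (rule Trunc_nonzero)
    define M where "M = (LEAST M. Trunc N M \<noteq> {0})"
    have M: "Trunc N M \<noteq> {0}" "M \<le> N"
      unfolding M_def using N(2) by (fact LeastI, fact Least_le)
    have M_least: "Trunc N m = {0}" if "m < M" for m
      using that not_less_Least unfolding M_def by blast
    have inj: "w = 0" if "w \<in> Trunc N M" "M = Suc k" "I_coeff k w = 0" for w k
      using M_least[of k] Trunc_SucD_I[of w N k] that by auto
    have "M = 0"
    proof (rule ccontr)
      assume "M \<noteq> 0"
      then consider "M = 1" | k where "M = Suc (Suc k)" by (metis One_nat_def not0_implies_Suc)
      then show False
      proof cases
        case 1
        (* [D, L_1] = I_0, and I_0 commutes with both. *)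
        obtain w where "w \<in> Trunc N M" "w \<noteq> 0" "I_coeff 0 w = 0"
          by (rule M.C.no_canonical_commutation[OF D_linear L_coeff_linear[of "Suc 0"] I_coeff_linear[of 0]
                Trunc_subspace[of N M] _ _ _ finite_span_Trunc M(1)])
            (use N 1 M in \<open>auto simp: Trunc_L_1 Trunc_I_0 Trunc_D D_I_commute D_L_commutator
                L_I_0_commute\<close>)
        then show False using inj 1 by auto
      next
        case 2
        (* I_(k+1) lowers eigenvalues of L_1 by k+1. *)
        obtain w where "w \<in> Trunc N M" "w \<noteq> 0" "I_coeff (Suc k) w = 0"
          by (rule M.C.weight_operator_not_injective[OF L_coeff_linear[of "Suc 0"] I_coeff_linear[of "Suc k"]
                Trunc_subspace[of N M] _ _ finite_span_Trunc M(1) L_1_I_commutator])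
            (use N 2 M in \<open>auto simp: Trunc_L_1 Trunc_I_Suc simp del: of_nat_Suc\<close>)
        then show False using inj 2 by auto
      qed
    qed
    with M obtain w where "w \<in> Trunc N 0" "w \<noteq> 0" using M.C.subspace_0[OF Trunc_subspace] by blast
    then show ?thesis by (auto simp: U_def Trunc_def)
  qed
  ultimately show ?thesis by (auto simp: U_def)
qed

text \<open>As \<open>I = 0\<close>, the relation \<open>[L\<^sub>1, L\<^sub>n] = (1 - n) L\<^sub>n\<close> makes \<open>L\<^sub>n\<close> non-injective for \<open>n \<ge> 2\<close>, so the degree
  bound of a nonzero vector can be lowered until it reaches 2. At \<open>n = 1\<close> the factor vanishes, which is
  how \<open>\<Delta>\<close> survives.\<close>
lemma Trunc_2_nonzero: "Trunc 2 0 \<noteq> {0}"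
proof -
  define N where "N = (LEAST N. Trunc N 0 \<noteq> {0})"
  have "\<exists>N. Trunc N 0 \<noteq> {0}"
  proof -
    obtain N where "Trunc N N \<noteq> {0}" using Trunc_nonzero by blast
    moreover have "Trunc N N = Trunc N 0" by (simp add: Trunc_def I_acts_zero)
    ultimately show ?thesis by auto
  qed
  then have N: "Trunc N 0 \<noteq> {0}"
    unfolding N_def by (rule LeastI_ex)
  have N_least: "Trunc n 0 = {0}" if "n < N" for n
    using that not_less_Least unfolding N_def by blast
  have "N \<le> 2"
  proof (rule ccontr)
    assume "\<not> N \<le> 2"
    then obtain k where k: "N = Suc (Suc k)" "0 < k"
      by (metis Suc_le_D le_SucI not_less_eq_eq numeral_2_eq_2 gr0I le_refl)
    have comm: "L_coeff (Suc 0) (L_coeff (Suc k) w) - L_coeff (Suc k) (L_coeff (Suc 0) w) =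
        sV [:- of_nat k:] (L_coeff (Suc k) w)" for w
      using L_1_L_commutator[of "Suc k" w] by (simp add: LI_coeff_def I_acts_zero)
    obtain w where "w \<in> Trunc N 0" "w \<noteq> 0" "L_coeff (Suc k) w = 0"
      by (rule M.C.weight_operator_not_injective[OF L_coeff_linear[of "Suc 0"] L_coeff_linear[of "Suc k"]
            Trunc_subspace[of N 0] _ _ finite_span_Trunc N comm])
        (use k in \<open>auto simp: Trunc_L_1 Trunc_L_Suc\<close>)
    then show False using N_least[of "Suc k"] Trunc_SucD_L[of w "Suc k" 0] k by auto
  qed
  then have "Trunc N 0 \<subseteq> Trunc 2 0" by (auto simp: Trunc_def)
  with N show ?thesis using M.C.subspace_0[OF Trunc_subspace] by blast
qed

lemma generator_exists:
  obtains v \<Delta> \<alpha> where "v \<noteq> 0" "\<Delta> \<noteq> 0"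
    "L_coeff 0 v = sV (del + [:\<alpha>:]) v" "L_coeff (Suc 0) v = sV [:\<Delta>:] v" "\<forall>n\<ge>2. L_coeff n v = 0"
proof -
  obtain v \<Delta> d where v: "v \<in> Trunc 2 0" "v \<noteq> 0" "L_coeff (Suc 0) v = sV [:\<Delta>:] v" "D v = sV [:d:] v"
    by (rule M.C.common_eigenvector_exists[OF L_coeff_linear[of "Suc 0"] D_linear
          Trunc_subspace[of 2 0] _ _ _ finite_span_Trunc Trunc_2_nonzero])
      (auto simp: Trunc_L_1 Trunc_D D_L_commutator I_acts_zero)
  define u where "u = L_coeff 0 v"
  have l0: "L_coeff 0 v = sV (del + [:-d:]) v"
    using v(4) by (simp only: D_def M.V.scale_left_distrib M.C.scale_minus_left) (simp add: algebra_simps)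
  have l2: "L_coeff n v = 0" if "2 \<le> n" for n using v(1) that by (simp add: Trunc_def)
  show ?thesis
  proof (cases "\<Delta> = 0")
    case False
    with v l0 l2 that show ?thesis by blast
  next
    case True
    (* Here \<alpha> = - d and u = (del + \<alpha>) v, so L_\<lambda> u = (del + \<lambda> + \<alpha>) L_\<lambda> v = (del + \<alpha> + \<lambda>) u. *)
    then have l1: "L_coeff n v = 0" if "1 \<le> n" for n using v(3) l2 that by (cases "n = 1") auto
    have lu: "L_coeff n u = sV (del + [:-d:]) (L_coeff n v) +
        (case n of 0 \<Rightarrow> 0 | Suc k \<Rightarrow> L_coeff k v)" for n
      unfolding u_def l0
      by (simp only: M.V.scale_left_distrib L_coeff.add L_coeff.scale L_coeff_del) (simp add: algebra_simps)
    have "u \<noteq> 0"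
    proof
      assume "u = 0"
      then have "L_coeff n v = 0" for n using l1 by (cases n) (auto simp: u_def)
      then show False using zero_if_annihilated I_acts_zero v(2) by blast
    qed
    then show ?thesis
    proof (rule that[of u 1 "-d"])
      show "L_coeff 0 u = sV (del + [:- d:]) u" using lu[of 0] by (simp add: u_def)
      show "L_coeff (Suc 0) u = sV [:1:] u" using lu[of 1] l1 by (simp add: u_def)
      show "\<forall>n\<ge>2. L_coeff n u = 0" using lu l1 by (simp split: nat.split)
    qed simp
  qed
qed

section \<open>The free module of rank one\<close>

lemma range_scale_UNIV:
  assumes "v \<noteq> 0" and "\<And>n. \<exists>p. L_coeff n v = sV p v"
  shows "range (\<lambda>p. sV p v) = UNIV"
proof -
  define U where "U = range (\<lambda>p. sV p v)"
  have U: "M.V.subspace U"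
    unfolding U_def M.V.span_singleton[symmetric] by (rule M.V.subspace_span)
  have scale: "sV p u \<in> U" if "u \<in> U" for p u
    using U that by (rule M.V.subspace_scale)
  have "L_coeff n (sV p v) \<in> U" for n p
  proof (induction p arbitrary: n)
    case 0
    then show ?case using M.V.subspace_0[OF U] by simp
  next
    case (pCons c p)
    have "L_coeff n v \<in> U" for n using assms(2)[of n] by (auto simp: U_def)
    then show ?case
      unfolding scale_pCons[OF M.V.module_axioms, of c p v] L_coeff.add L_coeff.scale L_coeff_del
      using pCons.IH by (auto intro!: M.V.subspace_add[OF U] scale M.V.subspace_0[OF U] split: nat.split)
  qed
  then have "L_coeff n u \<in> U" if "u \<in> U" for n u using that by (auto simp: U_def)
  then have "conformal_submodule sV act U"
    using U act_in_subspace[OF U] M.V.subspace_0[OF U] by (simp add: conformal_submodule_def I_acts_zero)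
  then have "U = {0} \<or> U = UNIV" using irreducible by (simp add: irreducible_module_def)
  moreover have "sV 1 v \<in> U" unfolding U_def by blast
  ultimately show ?thesis using assms(1) by (auto simp: U_def)
qed

lemma isomorphic_to_free_rank_one:
  obtains \<alpha> \<Delta> g where "\<Delta> \<noteq> 0" "module_hom sV (*) g" "bij g"
    "map_poly g (act L (inv g 1)) = lam_scale (*) [:del + [:\<alpha>:], [:\<Delta>:]:] 1"
    "map_poly g (act I (inv g 1)) = 0"
proof -
  obtain v \<Delta> \<alpha> where v: "v \<noteq> 0" "\<Delta> \<noteq> 0"
    "L_coeff 0 v = sV (del + [:\<alpha>:]) v" "L_coeff (Suc 0) v = sV [:\<Delta>:] v" "\<forall>n\<ge>2. L_coeff n v = 0"
    by (rule generator_exists)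
  define f where "f p = sV p v" for p
  have ln: "L_coeff n v = f (coeff [:del + [:\<alpha>:], [:\<Delta>:]:] n)" for n
  proof -
    consider "n = 0" | "n = Suc 0" | k where "n = Suc (Suc k)" by (metis not0_implies_Suc)
    then show ?thesis by cases (simp_all add: f_def v)
  qed
  interpret self: module "(*) :: complex poly \<Rightarrow> complex poly \<Rightarrow> complex poly"
    by unfold_locales (simp_all add: algebra_simps)
  interpret f: module_hom "(*)" sV f
    by unfold_locales (simp_all add: f_def M.V.scale_left_distrib)
  obtain a where "act a v \<noteq> 0" using act_nonzero v(1) by blast
  then have "inj f" unfolding f.inj_iff_eq_0 using M.torsion_free by (auto simp: f_def)
  moreover have "surj f" unfolding f_def using v(1) ln f_def by (intro range_scale_UNIV) auto
  ultimately have f: "bij f" by (simp add: bij_def)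
  define g where "g = inv f"
  have g: "module_hom sV (*) g" unfolding g_def
    by (intro module_pair.bij_module_hom_imp_inv_module_hom f f.module_hom_axioms) unfold_locales
  interpret g: module_hom sV "(*)" g by (rule g)
  have gf: "g (f p) = p" for p using \<open>inj f\<close> by (simp add: g_def)
  have "inv g = f" using f by (simp add: g_def inv_inv_eq)
  then have "inv g 1 = v" by (simp add: f_def)
  then have "coeff (map_poly g (act L (inv g 1))) n = coeff [:del + [:\<alpha>:], [:\<Delta>:]:] n" for n
    using ln[of n] by (simp add: coeff_map_poly gf L_coeff_def[symmetric] del: coeff_pCons)
  then have "map_poly g (act L (inv g 1)) = lam_scale (*) [:del + [:\<alpha>:], [:\<Delta>:]:] 1"
    by (intro poly_eqI) (simp add: lam_scale_def coeff_map_poly del: coeff_pCons)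
  moreover have "map_poly g (act I (inv g 1)) = 0"
    using I_acts_zero by (intro poly_eqI) (simp add: coeff_map_poly I_coeff_def[symmetric])
  moreover have "bij g" unfolding g_def using f by (rule bij_imp_bij_inv)
  ultimately show ?thesis using that v(2) g by blast
qed

end

section \<open>Transport of the action to \<open>\<complex>[\<partial>]\<close>\<close>

lemma conformal_module_transport:
  assumes V: "conformal_module sR br sV act" and g: "module_hom sV sW g" and "bij g"
  shows "conformal_module sR br sW (\<lambda>a w. map_poly g (act a (inv g w)))"
proof -
  interpret conformal_module sR br sV act by fact
  interpret g: module_hom sV sW g by fact
  have h: "module_hom sW sV (inv g)"
    by (intro module_pair.bij_module_hom_imp_inv_module_hom g \<open>bij g\<close>) unfold_locales
  interpret h: module_hom sW sV "inv g" by (rule h)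
  have hg: "inv g (g u) = u" for u using \<open>bij g\<close> by (simp add: bij_is_inj)
  have "sesquilinear_action sR sW (\<lambda>a w. map_poly g (act a (inv g w)))"
    by unfold_locales
      (auto intro!: poly_eqI simp: coeff_map_poly coeff_pCons g.add g.scale g.neg h.add h.scale
        M.add_left M.add_right M.scale_left M.scale_right M.del_left M.del_right split: nat.split)
  moreover have "commutator_identity br sW (\<lambda>a w. map_poly g (act a (inv g w)))"
    unfolding commutator_identity_def
  proof (intro allI)
    fix a b w m n
    have "g (coeff (act a (coeff (act b (inv g w)) n)) m - coeff (act b (coeff (act a (inv g w)) m)) n) =
      g (\<Sum>j\<le>m. coeff_sum_subst sV (act (coeff (br a b) j) (inv g w)) (m - j) n)"
      using commutator unfolding commutator_identity_def by simp
    then show "coeff (map_poly g (act a (inv g (coeff (map_poly g (act b (inv g w))) n)))) m -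
        coeff (map_poly g (act b (inv g (coeff (map_poly g (act a (inv g w))) m)))) n =
      (\<Sum>j\<le>m. coeff_sum_subst sW (map_poly g (act (coeff (br a b) j) (inv g w))) (m - j) n)"
      by (simp add: coeff_map_poly hg g.diff g.sum g.scale coeff_sum_subst_def)
  qed
  ultimately show ?thesis
    by (intro conformal_module.intro lie_conformal_algebra_axioms conformal_module_axioms.intro)
qed

theorem theorem3p3:
  fixes sR :: "complex poly \<Rightarrow> 'r::ab_group_add \<Rightarrow> 'r"
    and br :: "'r \<Rightarrow> 'r \<Rightarrow> 'r poly"
    and L I :: 'r
    and sV :: "complex poly \<Rightarrow> 'v::ab_group_add \<Rightarrow> 'v"
    and act :: "'r \<Rightarrow> 'v \<Rightarrow> 'v poly"
  assumes "algebra_R sR br L I"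
    and "conformal_module sR br sV act"
    and "finite_module sV"
    and "\<not> trivial_action act"
    and "irreducible_module sV act"
  shows "\<exists>(\<alpha>::complex) (\<Delta>::complex) actW.
           \<Delta> \<noteq> 0 \<and> is_V_module sR br L I \<alpha> \<Delta> actW \<and> isomorphic_modules sV act (*) actW"
proof -
  interpret irreducible_R_module sR br L I sV act
    using assms by (intro irreducible_R_module.intro R_module.intro irreducible_R_module_axioms.intro)
  obtain \<alpha> \<Delta> g where g: "\<Delta> \<noteq> 0" "module_hom sV (*) g" "bij g"
    "map_poly g (act L (inv g 1)) = lam_scale (*) [:del + [:\<alpha>:], [:\<Delta>:]:] 1"
    "map_poly g (act I (inv g 1)) = 0"
    by (rule isomorphic_to_free_rank_one)
  define actW where "actW a w = map_poly g (act a (inv g w))" for a w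
  have "conformal_module sR br (*) actW"
    unfolding actW_def[abs_def] by (rule conformal_module_transport[OF assms(2) g(2,3)])
  then have "is_V_module sR br L I \<alpha> \<Delta> actW"
    using g(4,5) by (simp add: is_V_module_def actW_def)
  moreover have "isomorphic_modules sV act (*) actW"
    unfolding isomorphic_modules_def using g(2,3)
    by (intro exI[of _ g]) (simp add: actW_def bij_is_inj)
  ultimately show ?thesis using g(1) by blast
qed

end
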